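(* Let $X$ be a real random variable with mean $\mu$ and variance $\sigma^2\in(0,\infty)$, let $\delta\in(0,1]$ with $\mathbb{E}|X-\mu|^{2+\delta}<\infty$, let $\eta>0$ be such that for some constant $K$ the tail remainder satisfies $\mathbb{E}[|X-\mu|^{2+\delta}\mathbf{1}\{h(X)>R\}]\le K R^{-\eta}$, where $h$ is a regular exhaustion function, and let $q>0$ and $\beta\in\mathbb{R}$. Consider the three terms $$n^{\beta(1-\delta)-\frac12},\qquad n^{-\beta\eta},\qquad n^{-\beta q}.$$ All three terms are $O(n^{-1/2})$ as $n\to\infty$ if and only if $$\beta(1-\delta)\le 0,\qquad \beta\eta\ge\tfrac12,\qquad \beta q\ge\tfrac12 .$$ The last two conditions force $\beta>0$; the first then forces $\delta=1$, i.e. $\mathbb{E}|X-\mu|^3<\infty$. In particular, whenever $\mathbb{E}|X-\mu|^3=\infty$, there is no choice of $(\beta,q,\delta,\eta)$ with $\beta\in\mathbb{R}$, $q>0$, $\delta\in(0,1]$ satisfying $\mathbb{E}|X-\mu|^{2+\delta}<\infty$, and $\eta>0$ satisfying $\mathbb{E}[|X-\mu|^{2+\delta}\mathbf{1}\{h(X)>R\}]\le K R^{-\eta}$ for some constant $K$, for which all three terms are $O(n^{-1/2})$, i.e. no choice yields the rate $n^{-1/2}$ through the truncation scheme whose error terms these are.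
   Context: A regular exhaustion function is a function $h:\mathbb{R}\to[0,\infty)$ that is Borel and locally bounded, satisfies $h(t)\to\infty$ as $|t|\to\infty$, and for which there are $c_1,c_2>0$ and $t_0\ge 0$ with $c_1|t|\le h(t)\le c_2|t|$ for all $|t|\ge t_0$. The "truncation scheme" is a method for bounding the weighted distance $\sup_t(1+h(t))^{-q}|P(Z_n\le t)-\Phi(t)|$ of a normalized i.i.d. sum $Z_n$ from the standard normal cdf $\Phi$ by truncating the summands at level $R_n=n^\beta$; the three terms $n^{\beta(1-\delta)-\frac12}$, $n^{-\beta\eta}$, $n^{-\beta q}$ are its error terms: the first is the order of the Berry–Esseen term for the truncated core, the second the order of the tail remainder (with $\eta$ the exponent in the bound $\mathbb{E}[|X-\mu|^{2+\delta}\mathbf{1}\{h(X)>R\}]\le K R^{-\eta}$), and the third the order of the weight on the region $\{h>R_n\}$. The scheme yields the rate $n^{-1/2}$ exactly when all three terms are $O(n^{-1/2})$. *)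

theory Defs
  imports "HOL-Probability.Probability" "HOL-Library.Landau_Symbols"
begin

definition locally_bounded :: "(real \<Rightarrow> real) \<Rightarrow> bool" where
  "locally_bounded h \<longleftrightarrow> (\<forall>t. \<exists>U. open U \<and> t \<in> U \<and> bounded (h ` U))"

definition regular_exhaustion :: "(real \<Rightarrow> real) \<Rightarrow> bool" where
  "regular_exhaustion h \<longleftrightarrow>
     (\<forall>t. 0 \<le> h t) \<and>
     h \<in> borel_measurable borel \<and>
     locally_bounded h \<and>
     filterlim h at_top at_infinity \<and>
     (\<exists>c1 c2 t0. c1 > 0 \<and> c2 > 0 \<and> t0 \<ge> 0 \<and>
        (\<forall>t. \<bar>t\<bar> \<ge> t0 \<longrightarrow> c1 * \<bar>t\<bar> \<le> h t \<and> h t \<le> c2 * \<bar>t\<bar>))"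

(* The (2+\<delta>)-th absolute moment about m is required to be finite wherever this predicate is used,
   so the Bochner integral is the genuine expectation, and starting the range of R at 0 rather than
   at some other threshold only affects the value of K. *)
definition tail_remainder_bound ::
  "'a measure \<Rightarrow> ('a \<Rightarrow> real) \<Rightarrow> real \<Rightarrow> (real \<Rightarrow> real) \<Rightarrow> real \<Rightarrow> real \<Rightarrow> bool" where
  "tail_remainder_bound M X m h \<delta> \<eta> \<longleftrightarrow>
     (\<exists>K. \<forall>R>0. (\<integral>\<omega>. \<bar>X \<omega> - m\<bar> powr (2 + \<delta>) * indicator {\<omega>. h (X \<omega>) > R} \<omega> \<partial>M)
                  \<le> K * R powr (- \<eta>))"

(* Orders of the three error terms of the truncation scheme at level R_n = n powr \<beta>:
   the Berry-Esseen term of the truncated core, the tail remainder, and the weight on {h > R_n}. *)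
definition core_term :: "real \<Rightarrow> real \<Rightarrow> nat \<Rightarrow> real" where
  "core_term \<beta> \<delta> n = real n powr (\<beta> * (1 - \<delta>) - 1 / 2)"

definition tail_term :: "real \<Rightarrow> real \<Rightarrow> nat \<Rightarrow> real" where
  "tail_term \<beta> \<eta> n = real n powr (- \<beta> * \<eta>)"

definition weight_term :: "real \<Rightarrow> real \<Rightarrow> nat \<Rightarrow> real" where
  "weight_term \<beta> q n = real n powr (- \<beta> * q)"

(* By definition, the scheme yields the rate n^(-1/2) when all three error terms are of that order. *)
definition scheme_yields_root_n_rate :: "real \<Rightarrow> real \<Rightarrow> real \<Rightarrow> real \<Rightarrow> bool" where
  "scheme_yields_root_n_rate \<beta> q \<delta> \<eta> \<longleftrightarrow>
     core_term \<beta> \<delta> \<in> O(\<lambda>n. real n powr (- 1 / 2)) \<and>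
     tail_term \<beta> \<eta> \<in> O(\<lambda>n. real n powr (- 1 / 2)) \<and>
     weight_term \<beta> q \<in> O(\<lambda>n. real n powr (- 1 / 2))"

end

theory Submission imports Defs begin

text \<open>Since n tends to infinity, powers of n are ordered like their exponents, so the three
  asymptotic conditions amount to three inequalities between exponents
  (\<open>scheme_yields_root_n_rate_iff\<close>). They pull against each other: a small tail
  remainder and a small weight need a truncation level n^\<beta> that grows, that is \<beta> > 0
  (\<open>pos_if_half_le_mult\<close>), while a growing level costs the core a factor n^(\<beta>(1 -
  \<delta>)), which stays bounded only for \<delta> = 1 (\<open>one_if_mult_diff_nonpos\<close>).
  The moment assumed finite is then the third one, so an infinite third moment rules out every
  choice of parameters.\<close>

lemma real_powr_bigo_iff:
  "(\<lambda>n. real n powr a) \<in> O(\<lambda>n. real n powr b) \<longleftrightarrow> a \<le> b"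
  by (rule powr_bigo_iff[OF filterlim_real_sequentially sequentially_bot])

lemma scheme_yields_root_n_rate_iff:
  "scheme_yields_root_n_rate \<beta> q \<delta> \<eta> \<longleftrightarrow>
     \<beta> * (1 - \<delta>) \<le> 0 \<and> \<beta> * \<eta> \<ge> 1 / 2 \<and> \<beta> * q \<ge> 1 / 2"
  unfolding scheme_yields_root_n_rate_def core_term_def tail_term_def weight_term_def
    real_powr_bigo_iff
  by auto

lemma pos_if_half_le_mult:
  fixes \<beta> \<eta> :: real
  assumes "0 < \<eta>" "1 / 2 \<le> \<beta> * \<eta>"
  shows "0 < \<beta>"
proof -
  have "0 < \<beta> * \<eta>"
    using assms(2) by simp
  then show ?thesis
    using assms(1) by (simp add: zero_less_mult_iff)
qed

lemma one_if_mult_diff_nonpos: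
  fixes \<beta> \<delta> :: real
  assumes "0 < \<beta>" "\<beta> * (1 - \<delta>) \<le> 0" "\<delta> \<le> 1"
  shows "\<delta> = 1"
  using assms by (auto simp: mult_le_0_iff)

text \<open>Links the moment of order 2 + \<delta> at \<delta> = 1 to the cube in the theorem; it
  holds also at x = 0, where both sides vanish. The exponent is left as \<open>2 + 1\<close>, the
  form that appears once \<delta> is replaced by 1.\<close>

lemma abs_powr_three: "\<bar>x :: real\<bar> powr (2 + 1) = \<bar>x\<bar> ^ 3"
  by (simp add: powr_numeral)

theorem proposition2p1:
  fixes M :: "'a measure" and X :: "'a \<Rightarrow> real" and \<mu> \<sigma> :: real and h :: "real \<Rightarrow> real"
  assumes "prob_space M"
    and "X \<in> borel_measurable M"
    and "integrable M X"
    and "prob_space.expectation M X = \<mu>"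
    and "integrable M (\<lambda>\<omega>. (X \<omega> - \<mu>)\<^sup>2)"
    and "prob_space.variance M X = \<sigma>\<^sup>2"
    and "0 < \<sigma>\<^sup>2"
    and "regular_exhaustion h"
  shows
    "(\<forall>\<delta> \<eta> q \<beta> :: real.
        0 < \<delta> \<and> \<delta> \<le> 1 \<and>
        integrable M (\<lambda>\<omega>. \<bar>X \<omega> - \<mu>\<bar> powr (2 + \<delta>)) \<and>
        0 < \<eta> \<and> tail_remainder_bound M X \<mu> h \<delta> \<eta> \<and>
        0 < q \<longrightarrow>
          (scheme_yields_root_n_rate \<beta> q \<delta> \<eta> \<longleftrightarrow>
             \<beta> * (1 - \<delta>) \<le> 0 \<and> \<beta> * \<eta> \<ge> 1 / 2 \<and> \<beta> * q \<ge> 1 / 2) \<and>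
          (\<beta> * \<eta> \<ge> 1 / 2 \<and> \<beta> * q \<ge> 1 / 2 \<longrightarrow> \<beta> > 0) \<and>
          (\<beta> > 0 \<and> \<beta> * (1 - \<delta>) \<le> 0 \<longrightarrow>
             \<delta> = 1 \<and> integrable M (\<lambda>\<omega>. \<bar>X \<omega> - \<mu>\<bar> ^ 3))) \<and>
     (\<not> integrable M (\<lambda>\<omega>. \<bar>X \<omega> - \<mu>\<bar> ^ 3) \<longrightarrow>
        \<not> (\<exists>\<beta> q \<delta> \<eta> :: real.
             0 < q \<and> 0 < \<delta> \<and> \<delta> \<le> 1 \<and>
             integrable M (\<lambda>\<omega>. \<bar>X \<omega> - \<mu>\<bar> powr (2 + \<delta>)) \<and>
             0 < \<eta> \<and> tail_remainder_bound M X \<mu> h \<delta> \<eta> \<and>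
             scheme_yields_root_n_rate \<beta> q \<delta> \<eta>))"
proof -
  have third_moment: "\<delta> = 1 \<and> integrable M (\<lambda>\<omega>. \<bar>X \<omega> - \<mu>\<bar> ^ 3)"
    if "0 < \<beta>" "\<beta> * (1 - \<delta>) \<le> 0" "\<delta> \<le> 1"
      and int: "integrable M (\<lambda>\<omega>. \<bar>X \<omega> - \<mu>\<bar> powr (2 + \<delta>))"
    for \<beta> \<delta> :: real
  proof -
    have "\<delta> = 1"
      using that(1-3) by (rule one_if_mult_diff_nonpos)
    \<comment> \<open>Rewriting \<delta> to 1 turns the assumed integrability into that of the third
      absolute moment.\<close>
    with int show ?thesis
      by (simp only: abs_powr_three simp_thms)
  qed
  show ?thesis
    \<comment> \<open>With the rate expressed through exponents, the claimed equivalence is trivial.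
      For the impossibility, an admissible choice would have \<beta> > 0, because \<eta> and q are
      positive, and hence a finite third moment.\<close>
    unfolding scheme_yields_root_n_rate_iff
    using pos_if_half_le_mult third_moment by blast
qed

end
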